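(* Let $\mathcal{A}, \mathcal{B} \in \mathbb{R}^{m \times n \times p}$ be orthogonally equivalent, $\mathcal{A} = \mathcal{Y} * \mathcal{B} * \mathcal{Z}^\top$, where $\mathcal{Y} \in \mathbb{R}^{m \times m \times p}$ and $\mathcal{Z} \in \mathbb{R}^{n \times n \times p}$ are orthogonal tensors. Then $\mathcal{S}(\mathcal{A}) = \mathcal{S}(\mathcal{B})$, where $\mathcal{S}(\cdot)$ is the Kilmer-Martin mapping.
   Context: For a third order tensor $\mathcal{A} = (a_{ijk}) \in \mathbb{R}^{m\times n\times p}$, let $A^{(k)} = (a_{ijk})_{i,j} \in \mathbb{R}^{m\times n}$, $k=1,\dots,p$, be its frontal slices. $\mathrm{bcirc}(\mathcal{A}) \in \mathbb{R}^{mp\times np}$ is the block circulant matrix whose $(s,t)$ block is $A^{(r)}$ with $r \in \{1,\dots,p\}$, $r \equiv s-t+1 \pmod p$ (first block column $A^{(1)},A^{(2)},\dots,A^{(p)}$); $\mathrm{bcirc}^{-1}$ is its inverse, defined on block circulant matrices. T-product: for $\mathcal{A}\in\mathbb{R}^{m\times s\times p}$, $\mathcal{B}\in\mathbb{R}^{s\times n\times p}$, $\mathcal{A}*\mathcal{B} := \mathrm{bcirc}^{-1}(\mathrm{bcirc}(\mathcal{A})\,\mathrm{bcirc}(\mathcal{B})) \in \mathbb{R}^{m\times n\times p}$. Transpose: $\mathcal{A}^\top := \mathrm{bcirc}^{-1}(\mathrm{bcirc}(\mathcal{A})^\top)$. Identity tensor: $\mathcal{I}_{nnp} := \mathrm{bcirc}^{-1}(I_{np})$.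 A tensor $\mathcal{Q}\in\mathbb{R}^{n\times n\times p}$ is orthogonal if $\mathcal{Q}*\mathcal{Q}^\top=\mathcal{Q}^\top*\mathcal{Q}=\mathcal{I}_{nnp}$. Tensors $\mathcal{A},\mathcal{B}\in\mathbb{R}^{m\times n\times p}$ are orthogonally equivalent if $\mathcal{A}=\mathcal{Y}*\mathcal{B}*\mathcal{Z}^\top$ for some orthogonal tensors $\mathcal{Y}\in\mathbb{R}^{m\times m\times p}$, $\mathcal{Z}\in\mathbb{R}^{n\times n\times p}$. Kilmer-Martin mapping: put $\omega=e^{-2\pi\sqrt{-1}/p}$ and $\Delta^{(k)}=\sum_{l=1}^p \omega^{(k-1)(l-1)}A^{(l)}\in\mathbb{C}^{m\times n}$ for $k=1,\dots,p$. Let $\Sigma(1,1,k)\ge\Sigma(2,2,k)\ge\cdots\ge\Sigma(\min\{m,n\},\min\{m,n\},k)\ge 0$ be the singular values of the matrix $\Delta^{(k)}$ in non-increasing order. Then $\mathcal{S}=\mathcal{S}(\mathcal{A})\in\mathbb{R}^{m\times n\times p}$ is the (real) tensor all of whose frontal slices are diagonal, with diagonal entries $\mathcal{S}(i,i,k)=\frac1p\sum_{l=1}^p\bar\omega^{(k-1)(l-1)}\Sigma(i,i,l)$ for $1\le i\le\min\{m,n\}$, $1\le k\le p$. *)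

theory Defs
  imports
    "HOL-Computational_Algebra.Fundamental_Theorem_Algebra"
    "Jordan_Normal_Form.Schur_Decomposition"
begin

text \<open>A third order tensor is the list of its frontal slices. All indices start at 0, so
  \<open>T ! k $$ (i, j)\<close> is the entry usually written $a_{i+1,j+1,k+1}$.\<close>

definition carrier_tensor :: "nat \<Rightarrow> nat \<Rightarrow> nat \<Rightarrow> 'a mat list set" where
  "carrier_tensor m n p = {T. length T = p \<and> set T \<subseteq> carrier_mat m n}"

abbreviation tdim_row :: "'a mat list \<Rightarrow> nat" where
  "tdim_row T \<equiv> dim_row (T ! 0)"

abbreviation tdim_col :: "'a mat list \<Rightarrow> nat" where
  "tdim_col T \<equiv> dim_col (T ! 0)"

text \<open>Entry \<open>(i, j)\<close> of the block circulant matrix lies in block \<open>(i div m, j div n)\<close>, at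
  position \<open>(i mod m, j mod n)\<close> of that block; block \<open>(s, t)\<close> is slice \<open>(s - t) mod p\<close>,
  where the difference is taken in the integers.\<close>

definition bcirc :: "'a mat list \<Rightarrow> 'a mat" where
  "bcirc T = (let m = tdim_row T; n = tdim_col T; p = length T in
     mat (m * p) (n * p) (\<lambda>(i, j).
       T ! nat ((int (i div m) - int (j div n)) mod int p) $$ (i mod m, j mod n)))"

text \<open>The block size cannot be read off from a matrix, so the inverse takes the format of the
  tensor as arguments. It is meaningful on the image of \<open>bcirc\<close> only; see \<open>inj_on_bcirc\<close>.\<close>

definition bcirc_inv :: "nat \<Rightarrow> nat \<Rightarrow> nat \<Rightarrow> 'a mat \<Rightarrow> 'a mat list" where
  "bcirc_inv m n p = the_inv_into (carrier_tensor m n p) bcirc"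

definition tprod :: "real mat list \<Rightarrow> real mat list \<Rightarrow> real mat list" (infixl "*\<^sub>T" 70) where
  "A *\<^sub>T B = bcirc_inv (tdim_row A) (tdim_col B) (length A) (bcirc A * bcirc B)"

definition ttranspose :: "real mat list \<Rightarrow> real mat list" where
  "ttranspose A = bcirc_inv (tdim_col A) (tdim_row A) (length A) (transpose_mat (bcirc A))"

definition tident :: "nat \<Rightarrow> nat \<Rightarrow> real mat list" where
  "tident n p = bcirc_inv n n p (1\<^sub>m (n * p))"

definition orthogonal_tensor :: "nat \<Rightarrow> nat \<Rightarrow> real mat list \<Rightarrow> bool" where
  "orthogonal_tensor n p Q \<longleftrightarrow> Q \<in> carrier_tensor n n p \<and>
     Q *\<^sub>T ttranspose Q = tident n p \<and> ttranspose Q *\<^sub>T Q = tident n p"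

text \<open>The singular values of an $m \times n$ matrix $M$, in non-increasing order: the square roots
  of the $\min\{m,n\}$ largest eigenvalues of $M^* M$, counted with algebraic multiplicity. These
  eigenvalues are real and nonnegative, so \<open>Re\<close> only changes the type. If \<open>m < n\<close>, the entries
  cut off are \<open>n - m\<close> zeros.\<close>

definition singular_values :: "complex mat \<Rightarrow> real list" where
  "singular_values M = take (min (dim_row M) (dim_col M))
     (rev (sorted_list_of_multiset
       (image_mset (\<lambda>e. sqrt (Re e)) (proots (char_poly (mat_adjoint M * M))))))"

definition root_unity :: "nat \<Rightarrow> complex" where
  "root_unity p = exp (- 2 * of_real pi * \<i> / of_nat p)"

definition km_Delta :: "real mat list \<Rightarrow> nat \<Rightarrow> complex mat" where
  "km_Delta A k = mat (tdim_row A) (tdim_col A) (\<lambda>(i, j).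
     \<Sum>l<length A. root_unity (length A) ^ (k * l) * of_real (A ! l $$ (i, j)))"

definition km_entry :: "real mat list \<Rightarrow> nat \<Rightarrow> nat \<Rightarrow> complex" where
  "km_entry A i k = 1 / of_nat (length A) *
     (\<Sum>l<length A. cnj (root_unity (length A)) ^ (k * l) *
        of_real (singular_values (km_Delta A l) ! i))"

text \<open>\<open>Re\<close> only changes the type here, since \<open>km_entry A i k\<close> is real; see \<open>of_real_km_map\<close>.\<close>

definition km_map :: "real mat list \<Rightarrow> real mat list" where
  "km_map A = map (\<lambda>k. mat (tdim_row A) (tdim_col A)
     (\<lambda>(i, j). if i = j then Re (km_entry A i k) else 0)) [0..<length A]"

lemma inj_on_bcirc:
  assumes p: "0 < p"
  shows "inj_on bcirc (carrier_tensor m n p)"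
proof (rule inj_onI)
  fix A B :: "'a mat list"
  assume A: "A \<in> carrier_tensor m n p" and B: "B \<in> carrier_tensor m n p"
    and eq: "bcirc A = bcirc B"
  have lA: "length A = p" and lB: "length B = p"
    using A B by (auto simp: carrier_tensor_def)
  have cA: "A ! k \<in> carrier_mat m n" and cB: "B ! k \<in> carrier_mat m n" if "k < p" for k
    using A B that unfolding carrier_tensor_def by (auto simp: subset_iff)
  have entry: "bcirc T $$ (k * m + i, j) = T ! k $$ (i, j)"
    if T: "length T = p" "\<And>k. k < p \<Longrightarrow> T ! k \<in> carrier_mat m n"
      and k: "k < p" and i: "i < m" and j: "j < n" for T :: "'a mat list" and k i j
  proof -
    have d: "tdim_row T = m" "tdim_col T = n" using T(2)[OF p] by auto
    have "k * m + i < (k + 1) * m" using i by simp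
    also have "\<dots> \<le> p * m" using k by (intro mult_le_mono1) simp
    finally have "k * m + i < m * p" by (simp add: mult.commute)
    moreover have "n * 1 \<le> n * p" using p by (intro mult_le_mono2) simp
    hence "j < n * p" using j by linarith
    ultimately show ?thesis
      using i j k by (simp add: bcirc_def Let_def d T(1))
  qed
  show "A = B"
  proof (rule nth_equalityI)
    fix k assume "k < length A"
    hence k: "k < p" using lA by simp
    show "A ! k = B ! k"
    proof (rule eq_matI)
      fix i j assume "i < dim_row (B ! k)" "j < dim_col (B ! k)"
      hence "i < m" "j < n" using cB[OF k] by auto
      thus "A ! k $$ (i, j) = B ! k $$ (i, j)"
        using entry[OF lA cA k, of i j] entry[OF lB cB k, of i j] unfolding eq by metis
    qed (use cA[OF k] cB[OF k] in auto)
  qed (simp add: lA lB)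
qed

lemma mat_adjoint_index:
  fixes M :: "complex mat"
  assumes "i < dim_col M" "j < dim_row M"
  shows "mat_adjoint M $$ (i, j) = cnj (M $$ (j, i))"
  using assms unfolding mat_adjoint_def mat_of_rows_def by simp

lemma length_singular_values:
  "length (singular_values M) = min (dim_row M) (dim_col M)"
proof -
  have "mat_adjoint M * M \<in> carrier_mat (dim_col M) (dim_col M)"
    unfolding mat_adjoint_def mat_of_rows_def by auto
  hence "degree (char_poly (mat_adjoint M * M)) = dim_col M"
    by (rule degree_monic_char_poly[THEN conjunct1])
  moreover have "length (sorted_list_of_multiset X) = size X" for X :: "real multiset"
    by (metis mset_sorted_list_of_multiset size_mset)
  ultimately show ?thesis
    by (simp add: singular_values_def size_proots_complex)
qed

lemma singular_values_cnj:
  "singular_values (map_mat cnj M) = singular_values M"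
proof -
  let ?N = "mat_adjoint M * M"
  have N: "?N \<in> carrier_mat (dim_col M) (dim_col M)"
    unfolding mat_adjoint_def mat_of_rows_def by auto
  have d: "dim_row (mat_adjoint M) = dim_col M" "dim_col (mat_adjoint M) = dim_row M"
    "dim_row (mat_adjoint (map_mat cnj M)) = dim_col M"
    "dim_col (mat_adjoint (map_mat cnj M)) = dim_row M"
    unfolding mat_adjoint_def mat_of_rows_def by auto
  have "mat_adjoint (map_mat cnj M) * map_mat cnj M = transpose_mat ?N"
  proof (rule eq_matI)
    fix i j assume "i < dim_row (transpose_mat ?N)" "j < dim_col (transpose_mat ?N)"
    hence i: "i < dim_col M" and j: "j < dim_col M" by (simp_all add: d)
    have "(mat_adjoint (map_mat cnj M) * map_mat cnj M) $$ (i, j) =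
        (\<Sum>k = 0..<dim_row M. M $$ (k, i) * cnj (M $$ (k, j)))"
      using i j by (simp add: d scalar_prod_def mat_adjoint_index)
    also have "\<dots> = transpose_mat ?N $$ (i, j)"
      using i j by (simp add: d scalar_prod_def mat_adjoint_index mult.commute)
    finally show "(mat_adjoint (map_mat cnj M) * map_mat cnj M) $$ (i, j) =
      transpose_mat ?N $$ (i, j)" .
  qed (simp_all add: d)
  thus ?thesis
    by (simp add: singular_values_def char_poly_transpose_mat[OF N])
qed

lemma root_unity_power: "0 < p \<Longrightarrow> root_unity p ^ p = 1"
proof -
  assume "0 < p"
  hence "root_unity p ^ p = exp (- (2 * of_real pi * \<i>))"
    by (simp add: root_unity_def flip: exp_of_nat_mult)
  thus ?thesis by (simp add: exp_minus)
qed

lemma cnj_root_unity: "cnj (root_unity p) = inverse (root_unity p)"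
proof -
  have "root_unity p = cis (- 2 * pi / of_nat p)"
    by (simp add: root_unity_def cis_conv_exp mult_ac)
  thus ?thesis by (simp add: cis_cnj)
qed

lemma root_unity_reflect:
  assumes "0 < p" "l \<le> p"
  shows "root_unity p ^ (k * (p - l)) = cnj (root_unity p) ^ (k * l)"
proof -
  have "root_unity p ^ (k * (p - l)) * root_unity p ^ (k * l) = (root_unity p ^ p) ^ k"
    unfolding power_add[symmetric] power_mult[symmetric] distrib_left[symmetric]
    using assms by (simp add: mult.commute[of p])
  hence "root_unity p ^ (k * (p - l)) * root_unity p ^ (k * l) = 1"
    by (simp add: root_unity_power assms)
  thus ?thesis
    unfolding cnj_root_unity power_inverse by (metis inverse_unique mult.commute)
qed

lemma km_Delta_reflect:
  assumes "0 < length A" "k \<le> length A"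
  shows "km_Delta A (length A - k) = map_mat cnj (km_Delta A k)"
  using assms
  by (intro eq_matI) (auto simp: km_Delta_def cnj_sum root_unity_reflect mult.commute)

lemma of_real_km_map:
  assumes A: "A \<in> carrier_tensor m n p" and i: "i < m" "i < n" and k: "k < p"
  shows "complex_of_real (km_map A ! k $$ (i, i)) = km_entry A i k"
proof -
  let ?w = "root_unity p"
  let ?s = "\<lambda>l. complex_of_real (singular_values (km_Delta A l) ! i)"
  let ?g = "\<lambda>l. cnj ?w ^ (k * l) * ?s l"
  have p: "0 < p" and lA: "length A = p" using k A by (auto simp: carrier_tensor_def)
  have "A ! 0 \<in> carrier_mat m n" using A p by (auto simp: carrier_tensor_def subset_iff)
  hence d: "tdim_row A = m" "tdim_col A = n" by auto
  have g0: "?g p = ?g 0"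
  proof -
    have "cnj ?w ^ (k * p) = cnj ((?w ^ p) ^ k)"
      by (simp only: power_mult[symmetric] complex_cnj_power mult.commute)
    thus ?thesis
      using km_Delta_reflect[of A 0] p lA by (simp add: singular_values_cnj root_unity_power)
  qed
  have refl: "?g (p - l) = cnj (?g l)" if "l \<le> p" for l
  proof -
    have "cnj (?w ^ (k * (p - l))) = cnj (cnj ?w ^ (k * l))"
      by (simp only: root_unity_reflect[OF p that])
    moreover have "?s (p - l) = ?s l"
      using km_Delta_reflect[of A l] p lA that by (simp add: singular_values_cnj)
    ultimately show ?thesis by simp
  qed
  have "cnj (\<Sum>l<p. ?g l) = (\<Sum>l<p. ?g (p - l))"
    unfolding cnj_sum by (rule sum.cong) (simp_all only: lessThan_iff refl less_imp_le)
  also have "\<dots> = (\<Sum>l<p. ?g (Suc l))"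
    by (subst sum.nat_diff_reindex[symmetric]) (auto intro!: sum.cong simp: Suc_diff_Suc)
  also have "\<dots> = (\<Sum>l<p. ?g l)"
    using sum.lessThan_Suc_shift[of ?g p] sum.lessThan_Suc[of ?g p] g0 by simp
  finally have "cnj (\<Sum>l<p. ?g l) = (\<Sum>l<p. ?g l)" .
  hence "cnj (km_entry A i k) = km_entry A i k"
    unfolding km_entry_def lA by (simp only: complex_cnj_mult complex_cnj_divide
      complex_cnj_one complex_cnj_of_nat)
  hence "complex_of_real (Re (km_entry A i k)) = km_entry A i k"
    by (metis Reals_cnj_iff of_real_Re)
  thus ?thesis using i k by (simp add: km_map_def lA d)
qed

end

theory Submission
  imports Defs
begin

text \<open>The discrete Fourier transform along the third index block-diagonalises every block
  circulant matrix by the same change of basis, with the matrices \<open>km_Delta A k\<close> as diagonal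
  blocks. For each fixed \<open>k\<close> the map \<open>A \<mapsto> km_Delta A k\<close> is therefore compatible
  with the tensor operations: it sends the T-product to the matrix product (\<open>km_Delta_tprod\<close>), the tensor
  transpose to the conjugate transpose (\<open>km_Delta_ttranspose\<close>), where it matters that the tensors
  are real, and the identity tensor to the identity matrix (\<open>km_Delta_tident\<close>). In particular it
  sends orthogonal tensors to unitary matrices (\<open>km_Delta_orthogonal\<close>).

  Hence \<open>A = Y * B * Z\<^sup>T\<close> becomes, for every \<open>k\<close>, a unitary equivalence between \<open>km_Delta A k\<close> and
  \<open>km_Delta B k\<close>. Unitarily equivalent matrices have similar Gram matrices and so the same
  singular values (\<open>singular_values_unitary_equiv\<close>), and the Kilmer-Martin mapping sees a tensor
  through its format and these singular values only.

  This compatibility is checked on entries. The T-product is a cyclic convolution of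
  slices, so slices are indexed by integers modulo the number of slices; then both the
  convolution formula and the convolution theorem reduce to shift invariance of a sum over a full
  period (\<open>sum_periodic_shift\<close>).\<close>

section \<open>Sums over a full period\<close>

lemma sum_lessThan_int: "(\<Sum>u<p. f (int u)) = sum f {0..<int p}"
  by (rule sum.reindex_bij_witness[of _ nat int]) auto

lemma sum_periodic_shift:
  fixes f :: "int \<Rightarrow> 'a::comm_monoid_add"
  assumes per: "\<And>d. f (d mod int p) = f d"
  shows "(\<Sum>u<p. f (int u + c)) = (\<Sum>u<p. f (int u))"
proof (cases "p = 0")
  case False
  have "(\<Sum>u\<in>{0..<int p}. f (u + c)) = (\<Sum>u\<in>{0..<int p}. f u)"
    by (rule sum.reindex_bij_witness[of _ "\<lambda>u. (u - c) mod int p" "\<lambda>u. (u + c) mod int p"])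
      (use False in \<open>auto simp: mod_simps per\<close>)
  thus ?thesis by (simp only: sum_lessThan_int sum_lessThan_int[of "\<lambda>u. f (u + c)"])
qed simp

lemma sum_periodic_neg:
  fixes f :: "int \<Rightarrow> 'a::comm_monoid_add"
  assumes per: "\<And>d. f (d mod int p) = f d"
  shows "(\<Sum>u<p. f (- int u)) = (\<Sum>u<p. f (int u))"
proof (cases "p = 0")
  case False
  have "(\<Sum>u\<in>{0..<int p}. f (- u)) = (\<Sum>u\<in>{0..<int p}. f u)"
    by (rule sum.reindex_bij_witness[of _ "\<lambda>u. (- u) mod int p" "\<lambda>u. (- u) mod int p"])
      (use False in \<open>auto simp: mod_simps per\<close>)
  thus ?thesis by (simp only: sum_lessThan_int sum_lessThan_int[of "\<lambda>u. f (- u)"])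
qed simp

lemma sum_div_mod:
  fixes f :: "nat \<Rightarrow> nat \<Rightarrow> 'a::comm_monoid_add"
  shows "(\<Sum>c<q * p. f (c div q) (c mod q)) = (\<Sum>u<p. \<Sum>v<q. f u v)"
proof -
  have "(\<Sum>c<q * p. f (c div q) (c mod q)) =
      (\<Sum>u<p. \<Sum>c = u * q..<u * q + q. f (c div q) (c mod q))"
    by (simp only: sum.nat_group mult.commute[of q])
  also have "\<dots> = (\<Sum>u<p. \<Sum>v<q. f u v)"
  proof (rule sum.cong[OF refl])
    fix u
    show "(\<Sum>c = u * q..<u * q + q. f (c div q) (c mod q)) = (\<Sum>v<q. f u v)"
      by (rule sum.reindex_bij_witness[of _ "\<lambda>v. u * q + v" "\<lambda>c. c - u * q"])
        (auto simp: div_mult_self3 mod_mult_self3 le_iff_add)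
  qed
  finally show ?thesis .
qed

section \<open>The tensor operations as operations on cyclically indexed slices\<close>

definition slice :: "'a mat list \<Rightarrow> int \<Rightarrow> 'a mat" where
  "slice T d = T ! nat (d mod int (length T))"

lemma slice_mod: "slice T (d mod int (length T)) = slice T d"
  by (simp add: slice_def)

lemma slice_of_nat: "l < length T \<Longrightarrow> slice T (int l) = T ! l"
  by (simp add: slice_def)

lemma carrier_tensor_dims:
  assumes "T \<in> carrier_tensor m n p" "0 < p"
  shows "length T = p" "tdim_row T = m" "tdim_col T = n"
proof -
  show l: "length T = p" using assms by (simp add: carrier_tensor_def)
  hence "T ! 0 \<in> carrier_mat m n" using assms by (auto simp: carrier_tensor_def subset_iff)
  thus "tdim_row T = m" "tdim_col T = n" by auto
qed

lemma bcirc_dims [simp]: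
  assumes "T \<in> carrier_tensor m n p" "0 < p"
  shows "dim_row (bcirc T) = m * p" "dim_col (bcirc T) = n * p"
  by (simp_all add: bcirc_def carrier_tensor_dims[OF assms])

lemma bcirc_index:
  assumes "T \<in> carrier_tensor m n p" "0 < p" "a < m * p" "b < n * p"
  shows "bcirc T $$ (a, b) = slice T (int (a div m) - int (b div n)) $$ (a mod m, b mod n)"
  using assms by (simp add: bcirc_def carrier_tensor_dims[OF assms(1,2)] slice_def)

text \<open>\<open>bcirc_inv\<close> is specified by a description operator, so it can be computed only by exhibiting
  a preimage. A matrix whose entries depend on the two block numbers only through their
  difference modulo \<open>p\<close> has one, and its slices can be read off.\<close>

lemma bcirc_inv_block_circulant:
  fixes c :: "int \<Rightarrow> nat \<Rightarrow> nat \<Rightarrow> 'a"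
  assumes p: "0 < p" and M: "M \<in> carrier_mat (m * p) (n * p)"
    and per: "\<And>d i j. c (d mod int p) i j = c d i j"
    and ent: "\<And>a b. a < m * p \<Longrightarrow> b < n * p \<Longrightarrow>
      M $$ (a, b) = c (int (a div m) - int (b div n)) (a mod m) (b mod n)"
  shows "bcirc_inv m n p M \<in> carrier_tensor m n p"
    and "i < m \<Longrightarrow> j < n \<Longrightarrow> slice (bcirc_inv m n p M) d $$ (i, j) = c d i j"
proof -
  define T where "T = map (\<lambda>r. mat m n (\<lambda>(i, j). c (int r) i j)) [0..<p]"
  have T: "T \<in> carrier_tensor m n p" by (auto simp: T_def carrier_tensor_def)
  have sl: "slice T d $$ (i, j) = c d i j" if "i < m" "j < n" for d i j
    using p that by (simp add: slice_def T_def nat_less_iff per)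
  have "bcirc T = M"
  proof (rule eq_matI)
    fix a b assume "a < dim_row M" "b < dim_col M"
    hence ab: "a < m * p" "b < n * p" using M by auto
    hence "0 < m" "0 < n" by (auto intro: gr0I)
    thus "bcirc T $$ (a, b) = M $$ (a, b)"
      by (simp add: bcirc_index[OF T p ab] sl ent[OF ab])
  qed (use M in \<open>simp_all add: bcirc_dims[OF T p]\<close>)
  hence "bcirc_inv m n p M = T"
    unfolding bcirc_inv_def using the_inv_into_f_f[OF inj_on_bcirc[OF p] T] by simp
  thus "bcirc_inv m n p M \<in> carrier_tensor m n p"
    and "i < m \<Longrightarrow> j < n \<Longrightarrow> slice (bcirc_inv m n p M) d $$ (i, j) = c d i j"
    using T sl by simp_all
qed

lemma
  assumes A: "A \<in> carrier_tensor m q p" and B: "B \<in> carrier_tensor q n p" and p: "0 < p"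
  shows tprod_carrier: "A *\<^sub>T B \<in> carrier_tensor m n p"
    and slice_tprod: "i < m \<Longrightarrow> j < n \<Longrightarrow> slice (A *\<^sub>T B) d $$ (i, j) =
      (\<Sum>u<p. \<Sum>v<q. slice A (d - int u) $$ (i, v) * slice B (int u) $$ (v, j))"
proof -
  let ?h = "\<lambda>d i j e. \<Sum>v<q. slice A (d - e) $$ (i, v) * slice B e $$ (v, j)"
  let ?c = "\<lambda>d i j. \<Sum>u<p. ?h d i j (int u)"
  have lA: "length A = p" and lB: "length B = p"
    using A B p by (auto simp: carrier_tensor_dims)
  have sA: "slice A (d mod int p - e) = slice A (d - e)"
    "slice A (d - e mod int p) = slice A (d - e)" for d e
    unfolding slice_def lA by (simp_all add: mod_simps)
  have sB: "slice B (e mod int p) = slice B e" for e using slice_mod[of B] lB by simp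
  have M: "bcirc A * bcirc B \<in> carrier_mat (m * p) (n * p)"
    by (intro carrier_matI) (simp_all add: bcirc_dims[OF A p] bcirc_dims[OF B p])
  have ent: "(bcirc A * bcirc B) $$ (a, b) =
      ?c (int (a div m) - int (b div n)) (a mod m) (b mod n)"
    if a: "a < m * p" and b: "b < n * p" for a b
  proof -
    let ?s = "int (a div m)" and ?t = "int (b div n)" and ?i = "a mod m" and ?j = "b mod n"
    have "(bcirc A * bcirc B) $$ (a, b) =
        (\<Sum>c<q * p. bcirc A $$ (a, c) * bcirc B $$ (c, b))"
      using a b by (simp add: scalar_prod_def bcirc_dims[OF A p] bcirc_dims[OF B p]
          atLeast0LessThan)
    also have "\<dots> = (\<Sum>c<q * p. slice A (?s - int (c div q)) $$ (?i, c mod q) *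
        slice B (int (c div q) - ?t) $$ (c mod q, ?j))"
      by (intro sum.cong) (simp_all add: bcirc_index[OF A p a] bcirc_index[OF B p _ b])
    also have "\<dots> = (\<Sum>u<p. \<Sum>v<q. slice A (?s - int u) $$ (?i, v) *
        slice B (int u - ?t) $$ (v, ?j))"
      by (rule sum_div_mod)
    also have "\<dots> = (\<Sum>u<p. ?h (?s - ?t) ?i ?j (int u + (- ?t)))"
      by simp
    also have "\<dots> = ?c (?s - ?t) ?i ?j"
      by (rule sum_periodic_shift) (simp only: sA sB)
    finally show ?thesis .
  qed
  have eq: "A *\<^sub>T B = bcirc_inv m n p (bcirc A * bcirc B)"
    using A B p by (simp add: tprod_def carrier_tensor_dims)
  show "A *\<^sub>T B \<in> carrier_tensor m n p"
    unfolding eq by (rule bcirc_inv_block_circulant(1)[OF p M _ ent]) (simp only: sA)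
  show "slice (A *\<^sub>T B) d $$ (i, j) = ?c d i j" if "i < m" "j < n"
    unfolding eq by (rule bcirc_inv_block_circulant(2)[OF p M _ ent that]) (simp only: sA)
qed

lemma
  assumes A: "A \<in> carrier_tensor m n p" and p: "0 < p"
  shows ttranspose_carrier: "ttranspose A \<in> carrier_tensor n m p"
    and slice_ttranspose: "i < n \<Longrightarrow> j < m \<Longrightarrow>
      slice (ttranspose A) d $$ (i, j) = slice A (- d) $$ (j, i)"
proof -
  let ?c = "\<lambda>d i j. slice A (- d) $$ (j, i)"
  have lA: "length A = p" using A p by (auto simp: carrier_tensor_dims)
  have per: "?c (d mod int p) i j = ?c d i j" for d i j
    unfolding slice_def lA by (simp add: mod_simps)
  have M: "transpose_mat (bcirc A) \<in> carrier_mat (n * p) (m * p)"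
    by (intro carrier_matI) (simp_all add: bcirc_dims[OF A p])
  have ent: "transpose_mat (bcirc A) $$ (a, b) =
      ?c (int (a div n) - int (b div m)) (a mod n) (b mod m)"
    if "a < n * p" "b < m * p" for a b
    using that by (simp add: bcirc_dims[OF A p] bcirc_index[OF A p])
  have eq: "ttranspose A = bcirc_inv n m p (transpose_mat (bcirc A))"
    using A p by (simp add: ttranspose_def carrier_tensor_dims)
  show "ttranspose A \<in> carrier_tensor n m p"
    unfolding eq by (rule bcirc_inv_block_circulant(1)[OF p M per ent])
  show "slice (ttranspose A) d $$ (i, j) = ?c d i j" if "i < n" "j < m"
    unfolding eq by (rule bcirc_inv_block_circulant(2)[OF p M per ent that])
qed

lemma
  assumes p: "0 < p"
  shows tident_carrier: "tident n p \<in> carrier_tensor n n p"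
    and slice_tident: "i < n \<Longrightarrow> j < n \<Longrightarrow>
      slice (tident n p) d $$ (i, j) = (if d mod int p = 0 \<and> i = j then 1 else 0)"
proof -
  let ?c = "\<lambda>d i j. if d mod int p = 0 \<and> i = j then 1 else (0::real)"
  have ent: "1\<^sub>m (n * p) $$ (a, b) = ?c (int (a div n) - int (b div n)) (a mod n) (b mod n)"
    if a: "a < n * p" and b: "b < n * p" for a b
  proof -
    have "a div n < p" "b div n < p"
      using a b by (auto simp: less_mult_imp_div_less mult.commute)
    hence "(int (a div n) - int (b div n)) mod int p = 0 \<longleftrightarrow> a div n = b div n"
      by (metis mod_eq_dvd_iff mod_0_imp_dvd dvd_imp_mod_0 mod_less of_nat_eq_iff of_nat_mod)
    moreover have "a = b \<longleftrightarrow> a div n = b div n \<and> a mod n = b mod n"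
      by (metis div_mult_mod_eq)
    ultimately show ?thesis using a b by simp
  qed
  show "tident n p \<in> carrier_tensor n n p"
    unfolding tident_def by (rule bcirc_inv_block_circulant(1)[OF p _ _ ent]) simp_all
  show "slice (tident n p) d $$ (i, j) = ?c d i j" if "i < n" "j < n"
    unfolding tident_def by (rule bcirc_inv_block_circulant(2)[OF p _ _ ent that]) simp_all
qed

section \<open>The Fourier transform turns tensor operations into matrix operations\<close>

text \<open>The exponent is an integer so that characters can be evaluated at differences of slice
  numbers.\<close>

definition character :: "nat \<Rightarrow> nat \<Rightarrow> int \<Rightarrow> complex" where
  "character p k d = (root_unity p ^ k) powi d"

lemma root_unity_nonzero [simp]: "root_unity p \<noteq> 0"
  by (simp add: root_unity_def)

lemma character_add: "character p k (d + e) = character p k d * character p k e"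
  by (simp add: character_def power_int_add)

lemma character_neg: "character p k (- d) = cnj (character p k d)"
  by (simp add: character_def power_int_minus cnj_root_unity power_inverse
      power_int_inverse)

lemma character_mod:
  assumes "0 < p"
  shows "character p k (d mod int p) = character p k d"
proof -
  have "character p k (int p * (d div int p)) = ((root_unity p ^ p) ^ k) powi (d div int p)"
    by (simp add: character_def power_int_mult power_mult[symmetric] mult.commute)
  hence "character p k (int p * (d div int p)) = 1"
    by (simp add: root_unity_power[OF assms])
  hence "character p k (int p * (d div int p) + d mod int p) = character p k (d mod int p)"
    by (simp only: character_add mult_1)
  thus ?thesis by simp
qed

lemma km_Delta_carrier:
  assumes "A \<in> carrier_tensor m n p" "0 < p"
  shows "km_Delta A k \<in> carrier_mat m n"
  by (simp add: km_Delta_def carrier_tensor_dims[OF assms])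

lemma km_Delta_index:
  assumes A: "A \<in> carrier_tensor m n p" and p: "0 < p" and "i < m" "j < n"
  shows "km_Delta A k $$ (i, j) =
    (\<Sum>l<p. character p k (int l) * of_real (slice A (int l) $$ (i, j)))"
  using assms(3,4)
  by (auto simp: km_Delta_def carrier_tensor_dims[OF A p] character_def slice_of_nat power_mult
      intro!: sum.cong)

text \<open>The convolution theorem: the character splits as \<open>\<chi>(d) = \<chi>(d - u) \<chi>(u)\<close>, and for fixed \<open>u\<close>
  the difference \<open>d - u\<close> runs through a full period together with \<open>d\<close>.\<close>

lemma km_Delta_tprod:
  assumes A: "A \<in> carrier_tensor m q p" and B: "B \<in> carrier_tensor q n p" and p: "0 < p"
  shows "km_Delta (A *\<^sub>T B) k = km_Delta A k * km_Delta B k"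
proof (rule eq_matI)
  note cA = km_Delta_carrier[OF A p, of k] and cB = km_Delta_carrier[OF B p, of k]
  have AB: "A *\<^sub>T B \<in> carrier_tensor m n p" by (rule tprod_carrier[OF A B p])
  let ?\<chi> = "character p k"
  fix i j assume "i < dim_row (km_Delta A k * km_Delta B k)"
    "j < dim_col (km_Delta A k * km_Delta B k)"
  hence ij: "i < m" "j < n" using cA cB by auto
  let ?a = "\<lambda>d v. complex_of_real (slice A d $$ (i, v))"
  let ?b = "\<lambda>d v. complex_of_real (slice B d $$ (v, j))"
  have lA: "length A = p" using A p by (simp add: carrier_tensor_dims)
  have shift: "(\<Sum>d<p. ?\<chi> (int d - u) * ?a (int d - u) v) = (\<Sum>d<p. ?\<chi> (int d) * ?a (int d) v)"
    for u v
    using sum_periodic_shift[of "\<lambda>d. ?\<chi> d * ?a d v" p "- u"] slice_mod[of A]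
    by (simp add: character_mod[OF p] lA)
  have "km_Delta (A *\<^sub>T B) k $$ (i, j) =
      (\<Sum>d<p. ?\<chi> (int d) * (\<Sum>u<p. \<Sum>v<q. ?a (int d - int u) v * ?b (int u) v))"
    by (simp add: km_Delta_index[OF AB p ij] slice_tprod[OF A B p ij])
  also have "\<dots> = (\<Sum>d<p. \<Sum>u<p. \<Sum>v<q.
      (?\<chi> (int d - int u) * ?a (int d - int u) v) * (?\<chi> (int u) * ?b (int u) v))"
  proof -
    have "?\<chi> (int d) * (x * y) = (?\<chi> (int d - int u) * x) * (?\<chi> (int u) * y)" for d u x y
      using character_add[of p k "int d - int u" "int u"] by simp
    thus ?thesis
      unfolding sum_distrib_left by (intro sum.cong refl)
  qed
  also have "\<dots> = (\<Sum>u<p. \<Sum>v<q.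
      (\<Sum>d<p. ?\<chi> (int d - int u) * ?a (int d - int u) v) * (?\<chi> (int u) * ?b (int u) v))"
    unfolding sum_distrib_right by (subst sum.swap) (intro sum.cong refl sum.swap)
  also have "\<dots> = (\<Sum>v<q. \<Sum>u<p.
      (\<Sum>d<p. ?\<chi> (int d) * ?a (int d) v) * (?\<chi> (int u) * ?b (int u) v))"
    unfolding shift by (rule sum.swap)
  also have "\<dots> = (\<Sum>v<q. km_Delta A k $$ (i, v) * km_Delta B k $$ (v, j))"
    by (intro sum.cong refl)
      (simp add: km_Delta_index[OF A p ij(1)] km_Delta_index[OF B p _ ij(2)] sum_distrib_left)
  also have "\<dots> = (km_Delta A k * km_Delta B k) $$ (i, j)"
    using cA cB ij by (simp add: scalar_prod_def atLeast0LessThan)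
  finally show "km_Delta (A *\<^sub>T B) k $$ (i, j) = (km_Delta A k * km_Delta B k) $$ (i, j)" .
qed (use km_Delta_carrier[OF A p, of k] km_Delta_carrier[OF B p, of k]
      km_Delta_carrier[OF tprod_carrier[OF A B p] p, of k] in auto)

lemma mat_adjoint_carrier: "M \<in> carrier_mat m n \<Longrightarrow> mat_adjoint M \<in> carrier_mat n m"
  unfolding mat_adjoint_def mat_of_rows_def by auto

text \<open>Transposition reverses the cyclic order of the slices, which conjugates the characters; the
  entries are real, so this conjugates the whole transform.\<close>

lemma km_Delta_ttranspose:
  assumes A: "A \<in> carrier_tensor m n p" and p: "0 < p"
  shows "km_Delta (ttranspose A) k = mat_adjoint (km_Delta A k)"
proof (rule eq_matI)
  let ?\<chi> = "character p k"
  note cA = km_Delta_carrier[OF A p, of k]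
  have lA: "length A = p" using A p by (simp add: carrier_tensor_dims)
  fix i j assume "i < dim_row (mat_adjoint (km_Delta A k))"
    "j < dim_col (mat_adjoint (km_Delta A k))"
  hence ij: "i < n" "j < m" using mat_adjoint_carrier[OF cA] by auto
  let ?f = "\<lambda>d. cnj (?\<chi> d) * complex_of_real (slice A d $$ (j, i))"
  have "km_Delta (ttranspose A) k $$ (i, j) = (\<Sum>l<p. ?f (- int l))"
    by (simp add: km_Delta_index[OF ttranspose_carrier[OF A p] p ij]
        slice_ttranspose[OF A p ij] character_neg)
  also have "\<dots> = (\<Sum>l<p. ?f (int l))"
    using slice_mod[of A] by (intro sum_periodic_neg) (simp add: character_mod[OF p] lA)
  also have "\<dots> = cnj (km_Delta A k $$ (j, i))"
    by (simp add: km_Delta_index[OF A p ij(2,1)] cnj_sum)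
  also have "\<dots> = mat_adjoint (km_Delta A k) $$ (i, j)"
    using cA ij by (simp add: mat_adjoint_index)
  finally show "km_Delta (ttranspose A) k $$ (i, j) = mat_adjoint (km_Delta A k) $$ (i, j)" .
qed (use mat_adjoint_carrier[OF km_Delta_carrier[OF A p, of k]]
      km_Delta_carrier[OF ttranspose_carrier[OF A p] p, of k] in auto)

lemma km_Delta_tident:
  assumes p: "0 < p"
  shows "km_Delta (tident n p) k = 1\<^sub>m n"
proof (rule eq_matI)
  fix i j assume "i < dim_row (1\<^sub>m n :: complex mat)" "j < dim_col (1\<^sub>m n :: complex mat)"
  hence ij: "i < n" "j < n" by auto
  have "km_Delta (tident n p) k $$ (i, j) =
      (\<Sum>l<p. if l = 0 then (if i = j then 1 else 0) else 0)"
    unfolding km_Delta_index[OF tident_carrier[OF p] p ij] slice_tident[OF p ij]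
    by (intro sum.cong) (auto simp: character_def)
  also have "\<dots> = 1\<^sub>m n $$ (i, j)" using p ij by simp
  finally show "km_Delta (tident n p) k $$ (i, j) = 1\<^sub>m n $$ (i, j)" .
qed (use km_Delta_carrier[OF tident_carrier[OF p] p, of n k] in auto)

lemma km_Delta_orthogonal:
  assumes Q: "orthogonal_tensor n p Q" and p: "0 < p"
  shows "mat_adjoint (km_Delta Q k) * km_Delta Q k = 1\<^sub>m n"
    and "km_Delta Q k * mat_adjoint (km_Delta Q k) = 1\<^sub>m n"
proof -
  have c: "Q \<in> carrier_tensor n n p" using Q by (simp add: orthogonal_tensor_def)
  note cT = ttranspose_carrier[OF c p]
  show "mat_adjoint (km_Delta Q k) * km_Delta Q k = 1\<^sub>m n"
    using Q by (simp add: orthogonal_tensor_def km_Delta_tident[OF p]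
        flip: km_Delta_ttranspose[OF c p] km_Delta_tprod[OF cT c p])
  show "km_Delta Q k * mat_adjoint (km_Delta Q k) = 1\<^sub>m n"
    using Q by (simp add: orthogonal_tensor_def km_Delta_tident[OF p]
        flip: km_Delta_ttranspose[OF c p] km_Delta_tprod[OF c cT p])
qed

section \<open>Unitary invariance of singular values\<close>

lemma mat_adjoint_mult:
  fixes M N :: "complex mat"
  assumes M: "M \<in> carrier_mat m q" and N: "N \<in> carrier_mat q n"
  shows "mat_adjoint (M * N) = mat_adjoint N * mat_adjoint M"
proof (rule eq_matI)
  note cM = mat_adjoint_carrier[OF M] and cN = mat_adjoint_carrier[OF N]
  fix i j assume "i < dim_row (mat_adjoint N * mat_adjoint M)"
    "j < dim_col (mat_adjoint N * mat_adjoint M)"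
  hence ij: "i < n" "j < m" using cM cN by auto
  thus "mat_adjoint (M * N) $$ (i, j) = (mat_adjoint N * mat_adjoint M) $$ (i, j)"
    using M N cM cN by (simp add: mat_adjoint_index scalar_prod_def cnj_sum mult.commute)
qed (use M N mat_adjoint_carrier[OF M] mat_adjoint_carrier[OF N]
      mat_adjoint_carrier[of "M * N" m n] in auto)

lemma mat_adjoint_adjoint:
  fixes M :: "complex mat"
  shows "mat_adjoint (mat_adjoint M) = M"
proof -
  note c = mat_adjoint_carrier[OF carrier_matI[OF refl refl], of M]
  show ?thesis
    by (rule eq_matI) (use c mat_adjoint_carrier[OF c] in \<open>auto simp: mat_adjoint_index\<close>)
qed

text \<open>The left factor cancels from the Gram matrix, and the right factor conjugates it.\<close>

lemma singular_values_unitary_equiv: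
  fixes M U W :: "complex mat"
  assumes M: "M \<in> carrier_mat m n" and U: "U \<in> carrier_mat m m" and W: "W \<in> carrier_mat n n"
    and UU: "mat_adjoint U * U = 1\<^sub>m m"
    and WW: "mat_adjoint W * W = 1\<^sub>m n" "W * mat_adjoint W = 1\<^sub>m n"
  shows "singular_values (U * M * mat_adjoint W) = singular_values M"
proof -
  let ?M' = "mat_adjoint M" and ?U' = "mat_adjoint U" and ?W' = "mat_adjoint W"
  note M' = mat_adjoint_carrier[OF M] and U' = mat_adjoint_carrier[OF U]
    and W' = mat_adjoint_carrier[OF W]
  have UM: "U * M \<in> carrier_mat m n" using U M by simp
  have "mat_adjoint (U * M * ?W') = W * (?M' * ?U')"
    by (simp add: mat_adjoint_mult[OF UM W'] mat_adjoint_mult[OF U M] mat_adjoint_adjoint)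
  hence "mat_adjoint (U * M * ?W') * (U * M * ?W') = W * (?M' * ?U') * (U * M * ?W')"
    by simp
  also have "\<dots> = W * (?M' * ?U') * (U * M) * ?W'"
    by (rule assoc_mult_mat[symmetric, of _ n m _ n _ n]) (use W M' U' UM W' in auto)
  also have "W * (?M' * ?U') * (U * M) = W * (?M' * ?U' * (U * M))"
    by (rule assoc_mult_mat[of _ n n _ m _ n]) (use W M' U' UM in auto)
  also have "?M' * ?U' * (U * M) = ?M' * (?U' * U * M)"
    using assoc_mult_mat[OF M' U' UM] assoc_mult_mat[OF U' U M] by simp
  also have "\<dots> = ?M' * M" using UU M by simp
  finally have gram: "mat_adjoint (U * M * ?W') * (U * M * ?W') = W * (?M' * M) * ?W'" .
  have "similar_mat (W * (?M' * M) * ?W') (?M' * M)"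
    unfolding similar_mat_def similar_mat_wit_def Let_def
    by (intro exI[of _ W] exI[of _ ?W']) (use W W' M M' WW in auto)
  from char_poly_similar[OF this] show ?thesis
    unfolding singular_values_def gram using U M W' by simp
qed

section \<open>Invariance of the Kilmer-Martin mapping\<close>

theorem theorem3p2:
  fixes A B Y Z :: "real mat list" and m n p :: nat
  assumes "0 < m" and "0 < n" and "0 < p"
    and "A \<in> carrier_tensor m n p" and "B \<in> carrier_tensor m n p"
    and "orthogonal_tensor m p Y" and "orthogonal_tensor n p Z"
    and "A = Y *\<^sub>T B *\<^sub>T ttranspose Z"
  shows "km_map A = km_map B"
proof -
  note p = \<open>0 < p\<close> and A = \<open>A \<in> carrier_tensor m n p\<close> and B = \<open>B \<in> carrier_tensor m n p\<close>
  have Y: "Y \<in> carrier_tensor m m p" and Z: "Z \<in> carrier_tensor n n p"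
    using assms(6,7) by (simp_all add: orthogonal_tensor_def)
  have "km_Delta A k = km_Delta Y k * km_Delta B k * mat_adjoint (km_Delta Z k)" for k
    by (simp add: assms(8) km_Delta_ttranspose[OF Z p] km_Delta_tprod[OF Y B p]
        km_Delta_tprod[OF tprod_carrier[OF Y B p] ttranspose_carrier[OF Z p] p])
  hence "singular_values (km_Delta A k) = singular_values (km_Delta B k)" for k
    using singular_values_unitary_equiv[OF km_Delta_carrier[OF B p] km_Delta_carrier[OF Y p]
        km_Delta_carrier[OF Z p] km_Delta_orthogonal(1)[OF assms(6) p]
        km_Delta_orthogonal[OF assms(7) p]] by simp
  hence entry: "km_entry A i k = km_entry B i k" for i k
    by (simp add: km_entry_def carrier_tensor_dims[OF A p] carrier_tensor_dims[OF B p])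
  show ?thesis
    unfolding km_map_def entry carrier_tensor_dims[OF A p] carrier_tensor_dims[OF B p] ..
qed

end
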